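(* Let $\tau$ be a congruence on the free semigroup $\mathfrak A^+$ such that for each $x\in\mathfrak A$, if $x\,\tau\,\mathbf u$ then $\mathbf u=x^m$ for some $m>0$. Let $W$ be a non-empty set of words in $\mathfrak A^+$ which is a union of $\tau$-classes and is closed under taking subwords. (a) If $S$ is a semigroup, then $\operatorname{var}S$ contains $S_\tau(W)$ if and only if every word in $W$ is a $\tau$-term for $S$. (b) If $S$ is a monoid, then $\operatorname{var}S$ contains $S^1_\tau(W)$ if and only if every word in $W$ is a $\tau$-term for $S$.
   Context: $\mathfrak A$ is a countably infinite alphabet of variables; $\mathfrak A^+$ and $\mathfrak A^*$ are the free semigroup and free monoid over it. Subwords are contiguous (and, for sets $W\subseteq\mathfrak A^+$, non-empty). Monoids are regarded as semigroups; $\operatorname{var}S$ is the variety of semigroups generated by $S$. A semigroup $S$ satisfies $\mathbf u\approx\mathbf v$ if $\Theta(\mathbf u)=\Theta(\mathbf v)$ for every homomorphism $\Theta:\mathfrak A^+\to S$. A word $\mathbf u$ is a $\tau$-term for $S$ if $\mathbf u\,\tau\,\mathbf v$ whenever $S$ satisfies $\mathbf u\approx\mathbf v$. "$W$ is a union of $\tau$-classes" means $\mathbf v\in W$ whenever $\mathbf u\in W$ and $\mathbf u\,\tau\,\mathbf v$. "Closed under taking subwords" means $\mathbf v\in W$ whenever $\mathbf u\in W$ and $\mathbf v$ is a subword of $\mathbf u$. Construction of $S_\tau(W)$ and $S^1_\tau(W)$: let $T=\mathfrak A^+/\tau$, let $T^1$ be the monoid obtained by adjoining an identity element $1$ to $T$,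 and let $H_\tau:\mathfrak A^*\to T^1$ be the natural homomorphism on $\mathfrak A^+$ extended by $H_\tau(\epsilon)=1$, where $\epsilon$ is the empty word. Let $I(W)=\mathfrak A^+\setminus W$. Then $H_\tau(I(W))$ (if non-empty) is an ideal of $T$ and of $T^1$. $S_\tau(W)$ is the Rees quotient of $T$ over $H_\tau(I(W))$, and $S^1_\tau(W)$ is the Rees quotient of $T^1$ over $H_\tau(I(W))$ (so all of $H_\tau(I(W))$ is collapsed to $0$, and nothing is collapsed if $I(W)$ is empty). *)

theory Defs
  imports
    "HOL-Algebra.Product_Groups"
    "HOL-Library.Sublist"
    "HOL-Library.Countable"
    "HOL-Library.Infinite_Typeclass"
begin

text \<open>
  Semigroups are carried by the \<open>monoid\<close> records of HOL-Algebra, so that \<^const>\<open>hom\<close>,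
  \<^const>\<open>epi\<close> and \<^const>\<open>product_group\<close> are available. In a record that is only known to be a
  semigroup the \<open>one\<close> field is junk; homomorphisms, subsemigroups and products do not depend on
  it. Semigroups are non-empty.
\<close>

definition is_semigroup :: "('s, 'z) monoid_scheme \<Rightarrow> bool" where
  "is_semigroup S \<longleftrightarrow> carrier S \<noteq> {} \<and>
     (\<forall>x\<in>carrier S. \<forall>y\<in>carrier S. x \<otimes>\<^bsub>S\<^esub> y \<in> carrier S) \<and>
     (\<forall>x\<in>carrier S. \<forall>y\<in>carrier S. \<forall>z\<in>carrier S.
        (x \<otimes>\<^bsub>S\<^esub> y) \<otimes>\<^bsub>S\<^esub> z = x \<otimes>\<^bsub>S\<^esub> (y \<otimes>\<^bsub>S\<^esub> z))"

definition subsemigroup :: "'s set \<Rightarrow> 's monoid \<Rightarrow> bool" where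
  "subsemigroup B S \<longleftrightarrow> B \<noteq> {} \<and> B \<subseteq> carrier S \<and> (\<forall>x\<in>B. \<forall>y\<in>B. x \<otimes>\<^bsub>S\<^esub> y \<in> B)"

section \<open>Words, identities, terms\<close>

text \<open>The free semigroup over the alphabet \<open>'a\<close>.\<close>

definition free_semigroup :: "'a list monoid" where
  "free_semigroup = \<lparr>carrier = {w. w \<noteq> []}, mult = (@), one = []\<rparr>"

definition satisfies :: "'s monoid \<Rightarrow> 'a list \<Rightarrow> 'a list \<Rightarrow> bool" where
  "satisfies S u v \<longleftrightarrow> (\<forall>\<Theta> \<in> hom free_semigroup S. \<Theta> u = \<Theta> v)"

definition tau_term :: "('a list \<times> 'a list) set \<Rightarrow> 's monoid \<Rightarrow> 'a list \<Rightarrow> bool" where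
  "tau_term \<tau> S u \<longleftrightarrow> (\<forall>v \<in> carrier free_semigroup. satisfies S u v \<longrightarrow> (u, v) \<in> \<tau>)"

definition union_of_classes :: "('a list \<times> 'a list) set \<Rightarrow> 'a list set \<Rightarrow> bool" where
  "union_of_classes \<tau> W \<longleftrightarrow> (\<forall>u v. u \<in> W \<longrightarrow> (u, v) \<in> \<tau> \<longrightarrow> v \<in> W)"

definition subword_closed :: "'a list set \<Rightarrow> bool" where
  "subword_closed W \<longleftrightarrow> (\<forall>u v. u \<in> W \<longrightarrow> v \<noteq> [] \<longrightarrow> sublist v u \<longrightarrow> v \<in> W)"

section \<open>Congruences, quotients and the Rees quotients of a word set\<close>

definition congruence_on :: "'s monoid \<Rightarrow> ('s \<times> 's) set \<Rightarrow> bool" where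
  "congruence_on S r \<longleftrightarrow> equiv (carrier S) r \<and>
     (\<forall>x x' y y'. (x, x') \<in> r \<longrightarrow> (y, y') \<in> r \<longrightarrow> (x \<otimes>\<^bsub>S\<^esub> y, x' \<otimes>\<^bsub>S\<^esub> y') \<in> r)"

text \<open>The union in the product is a single class when \<open>r\<close> is a congruence.\<close>

definition quotient_semigroup :: "'s monoid \<Rightarrow> ('s \<times> 's) set \<Rightarrow> 's set monoid" where
  "quotient_semigroup S r =
     \<lparr>carrier = carrier S // r,
      mult = (\<lambda>X Y. \<Union>x\<in>X. \<Union>y\<in>Y. r `` {x \<otimes>\<^bsub>S\<^esub> y}),
      one = r `` {\<one>\<^bsub>S\<^esub>}\<rparr>"

text \<open>For \<open>J = {}\<close> this is equality, so that nothing is collapsed.\<close>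

definition rees_congruence :: "'s monoid \<Rightarrow> 's set \<Rightarrow> ('s \<times> 's) set" where
  "rees_congruence S J = Id_on (carrier S) \<union> J \<times> J"

definition rees_quotient :: "'s monoid \<Rightarrow> 's set \<Rightarrow> 's set monoid" where
  "rees_quotient S J = quotient_semigroup S (rees_congruence S J)"

text \<open>The new identity \<open>None\<close> is adjoined even if \<open>S\<close> already has an identity.\<close>

definition adjoin_one :: "'s monoid \<Rightarrow> 's option monoid" where
  "adjoin_one S =
     \<lparr>carrier = insert None (Some ` carrier S),
      mult = (\<lambda>x y. case x of None \<Rightarrow> y
                | Some a \<Rightarrow> (case y of None \<Rightarrow> x | Some b \<Rightarrow> Some (a \<otimes>\<^bsub>S\<^esub> b))),
      one = None\<rparr>"

text \<open>
  The natural homomorphism on non-empty words, and its extension to all words with values in the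
  monoid with adjoined identity.
\<close>

definition nat_hom :: "('a list \<times> 'a list) set \<Rightarrow> 'a list \<Rightarrow> 'a list set" where
  "nat_hom \<tau> w = \<tau> `` {w}"

definition nat_hom1 :: "('a list \<times> 'a list) set \<Rightarrow> 'a list \<Rightarrow> 'a list set option" where
  "nat_hom1 \<tau> w = (if w = [] then None else Some (nat_hom \<tau> w))"

definition non_words :: "'a list set \<Rightarrow> 'a list set" where
  "non_words W = carrier free_semigroup - W"

definition S_of :: "('a list \<times> 'a list) set \<Rightarrow> 'a list set \<Rightarrow> 'a list set set monoid" where
  "S_of \<tau> W =
     rees_quotient (quotient_semigroup free_semigroup \<tau>) (nat_hom \<tau> ` non_words W)"

definition S1_of :: "('a list \<times> 'a list) set \<Rightarrow> 'a list set \<Rightarrow> 'a list set option set monoid" where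
  "S1_of \<tau> W =
     rees_quotient (adjoin_one (quotient_semigroup free_semigroup \<tau>)) (nat_hom1 \<tau> ` non_words W)"

section \<open>The variety generated by a semigroup\<close>

text \<open>\<open>T\<close> is a homomorphic image of a subsemigroup of the direct power of \<open>S\<close> over \<open>I\<close>.\<close>

definition image_of_sub_of_power :: "'i set \<Rightarrow> 's monoid \<Rightarrow> 't monoid \<Rightarrow> bool" where
  "image_of_sub_of_power I S T \<longleftrightarrow>
     (\<exists>B h. subsemigroup B (product_group I (\<lambda>_. S)) \<and>
            h \<in> epi ((product_group I (\<lambda>_. S)) \<lparr>carrier := B\<rparr>) T)"

text \<open>
  The variety generated by \<open>S\<close> is the class of all homomorphic images of subsemigroups of direct
  powers of \<open>S\<close>, the least class that contains \<open>S\<close> and is closed under homomorphic images,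
  subsemigroups and direct products. HOL cannot quantify over the type of the index
  set; index sets in \<open>'t \<Rightarrow> 's\<close> suffice for semigroups on \<open>'t\<close>, as \<open>in_varI\<close> below shows.
  The lemmas after it verify the closure properties and that \<open>in_var S\<close> is the class of
  semigroups satisfying all identities of \<open>S\<close>.
\<close>

definition in_var :: "'s monoid \<Rightarrow> 't monoid \<Rightarrow> bool" where
  "in_var S T \<longleftrightarrow> (\<exists>I :: ('t \<Rightarrow> 's) set. image_of_sub_of_power I S T)"

subsection \<open>Evaluation of words\<close>

fun weval :: "('s, 'z) monoid_scheme \<Rightarrow> ('a \<Rightarrow> 's) \<Rightarrow> 'a list \<Rightarrow> 's" where
  "weval S f [] = undefined"
| "weval S f [x] = f x"
| "weval S f (x # y # xs) = f x \<otimes>\<^bsub>S\<^esub> weval S f (y # xs)"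

lemma weval_Cons: "w \<noteq> [] \<Longrightarrow> weval S f (x # w) = f x \<otimes>\<^bsub>S\<^esub> weval S f w"
  by (cases w) auto

lemma weval_cong: "(\<And>x. x \<in> set w \<Longrightarrow> f x = g x) \<Longrightarrow> weval S f w = weval S g w"
  by (induction S f w rule: weval.induct) auto

lemma weval_map: "weval S f (map g w) = weval S (f \<circ> g) w"
  by (induction S "f \<circ> g" w rule: weval.induct) auto

lemma weval_restrict: "weval (S\<lparr>carrier := B\<rparr>) f w = weval S f w"
  by (induction S f w rule: weval.induct) auto

lemma weval_closed:
  assumes "\<And>x y. x \<in> B \<Longrightarrow> y \<in> B \<Longrightarrow> x \<otimes>\<^bsub>S\<^esub> y \<in> B"
    and "w \<noteq> []" "\<And>x. x \<in> set w \<Longrightarrow> f x \<in> B"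
  shows "weval S f w \<in> B"
  using assms(2,3) by (induction w rule: list_nonempty_induct) (auto simp: weval_Cons assms(1))

lemma weval_in_carrier:
  assumes "is_semigroup S" "w \<noteq> []" "\<And>x. x \<in> set w \<Longrightarrow> f x \<in> carrier S"
  shows "weval S f w \<in> carrier S"
  using assms(1) by (intro weval_closed assms) (auto simp: is_semigroup_def)

lemma weval_append:
  assumes "is_semigroup S" "u \<noteq> []" "v \<noteq> []" "\<And>x. x \<in> set u \<union> set v \<Longrightarrow> f x \<in> carrier S"
  shows "weval S f (u @ v) = weval S f u \<otimes>\<^bsub>S\<^esub> weval S f v"
  using assms(2,4)
proof (induction u rule: list_nonempty_induct)
  case (single x)
  then show ?case using assms(3) by (simp add: weval_Cons)
next
  case (cons x u)
  have "weval S f u \<in> carrier S" "weval S f v \<in> carrier S" "f x \<in> carrier S"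
    using cons.prems cons.hyps assms(1,3) by (auto intro!: weval_in_carrier)
  then show ?case
    using cons assms(1) by (auto simp: weval_Cons is_semigroup_def)
qed

lemma weval_hom:
  assumes "is_semigroup S" "\<And>x. f x \<in> carrier S"
  shows "weval S f \<in> hom free_semigroup S"
  using assms
  by (auto simp: hom_def free_semigroup_def weval_append intro!: weval_in_carrier)

lemma hom_weval:
  assumes "h \<in> hom S T" "is_semigroup S" "w \<noteq> []" "\<And>x. x \<in> set w \<Longrightarrow> f x \<in> carrier S"
  shows "h (weval S f w) = weval T (h \<circ> f) w"
  using assms(3,4)
proof (induction w rule: list_nonempty_induct)
  case (cons x w)
  then have "weval S f w \<in> carrier S" "f x \<in> carrier S"
    using assms(2) by (auto intro!: weval_in_carrier)
  then show ?case using cons assms(1) by (auto simp: weval_Cons hom_def)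
qed auto

lemma hom_free_eq_weval:
  assumes "\<Theta> \<in> hom free_semigroup S" "w \<noteq> []"
  shows "\<Theta> w = weval S (\<lambda>x. \<Theta> [x]) w"
  using assms(2)
proof (induction w rule: list_nonempty_induct)
  case (cons x w)
  have "\<Theta> ([x] @ w) = \<Theta> [x] \<otimes>\<^bsub>S\<^esub> \<Theta> w"
    using hom_mult[OF assms(1), of "[x]" w] cons.hyps by (simp add: free_semigroup_def)
  then show ?case using cons by (simp add: weval_Cons)
qed auto

lemma satisfies_iff:
  assumes "is_semigroup S" "u \<noteq> []" "v \<noteq> []"
  shows "satisfies S u v \<longleftrightarrow> (\<forall>f. range f \<subseteq> carrier S \<longrightarrow> weval S f u = weval S f v)"
proof
  assume "satisfies S u v"
  then show "\<forall>f. range f \<subseteq> carrier S \<longrightarrow> weval S f u = weval S f v"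
    unfolding satisfies_def using weval_hom[OF assms(1)] by (metis rangeI subsetD)
next
  assume R: "\<forall>f. range f \<subseteq> carrier S \<longrightarrow> weval S f u = weval S f v"
  have "\<Theta> u = \<Theta> v" if \<Theta>: "\<Theta> \<in> hom free_semigroup S" for \<Theta>
  proof -
    have "range (\<lambda>x. \<Theta> [x]) \<subseteq> carrier S"
      using \<Theta> by (auto simp: hom_def free_semigroup_def)
    then show ?thesis
      using R by (simp add: hom_free_eq_weval[OF \<Theta> assms(2)] hom_free_eq_weval[OF \<Theta> assms(3)])
  qed
  then show "satisfies S u v" unfolding satisfies_def by blast
qed

subsection \<open>Independence of the index type, identities, and closure properties\<close>

lemma is_semigroup_product:
  assumes "\<And>i. i \<in> I \<Longrightarrow> is_semigroup (S i)"
  shows "is_semigroup (product_group I S)"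
proof -
  have "carrier (S i) \<noteq> {}"
    and "x \<in> carrier (S i) \<Longrightarrow> y \<in> carrier (S i) \<Longrightarrow> x \<otimes>\<^bsub>S i\<^esub> y \<in> carrier (S i)"
    and "x \<in> carrier (S i) \<Longrightarrow> y \<in> carrier (S i) \<Longrightarrow> z \<in> carrier (S i) \<Longrightarrow>
           (x \<otimes>\<^bsub>S i\<^esub> y) \<otimes>\<^bsub>S i\<^esub> z = x \<otimes>\<^bsub>S i\<^esub> (y \<otimes>\<^bsub>S i\<^esub> z)"
    if "i \<in> I" for i x y z
    using assms[OF that] unfolding is_semigroup_def by blast+
  then show ?thesis
    unfolding is_semigroup_def
    by (auto simp: PiE_eq_empty_iff PiE_iff simp del: restrict_apply intro!: restrict_ext)
       (auto simp: PiE_iff)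
qed

lemma is_semigroup_sub:
  assumes "is_semigroup S" "subsemigroup B S"
  shows "is_semigroup (S\<lparr>carrier := B\<rparr>)"
  using assms unfolding is_semigroup_def subsemigroup_def by (auto simp: subset_iff)

lemma weval_product:
  assumes "w \<noteq> []" "i \<in> I"
  shows "weval (product_group I S) f w i = weval (S i) (\<lambda>x. f x i) w"
  using assms by (induction w rule: list_nonempty_induct) (auto simp: weval_Cons)

lemma satisfies_product:
  assumes "\<And>i. i \<in> I \<Longrightarrow> is_semigroup (S i)" "u \<noteq> []" "v \<noteq> []"
    and "\<And>i. i \<in> I \<Longrightarrow> satisfies (S i) u v"
  shows "satisfies (product_group I S) u v"
proof -
  let ?P = "product_group I S"
  have P: "is_semigroup ?P" using assms(1) by (rule is_semigroup_product)
  have "weval ?P f u = weval ?P f v" if f: "range f \<subseteq> carrier ?P" for f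
  proof (rule PiE_ext)
    show "weval ?P f u \<in> (\<Pi>\<^sub>E i\<in>I. carrier (S i))" "weval ?P f v \<in> (\<Pi>\<^sub>E i\<in>I. carrier (S i))"
      using weval_in_carrier[OF P, of _ f] f assms(2,3) by auto
    fix i assume i: "i \<in> I"
    have "range (\<lambda>x. f x i) \<subseteq> carrier (S i)" using f i by (auto simp: PiE_iff)
    then have "weval (S i) (\<lambda>x. f x i) u = weval (S i) (\<lambda>x. f x i) v"
      using assms(4)[OF i] unfolding satisfies_iff[OF assms(1)[OF i] assms(2,3)] by blast
    then show "weval ?P f u i = weval ?P f v i"
      using i assms(2,3) by (simp add: weval_product)
  qed
  then show ?thesis using satisfies_iff[OF P assms(2,3)] by blast
qed

lemma satisfies_sub:
  assumes "is_semigroup S" "subsemigroup B S" "u \<noteq> []" "v \<noteq> []" "satisfies S u v"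
  shows "satisfies (S\<lparr>carrier := B\<rparr>) u v"
proof -
  have "B \<subseteq> carrier S" using assms(2) by (simp add: subsemigroup_def)
  then show ?thesis
    using assms(5) satisfies_iff[OF assms(1,3,4)]
      satisfies_iff[OF is_semigroup_sub[OF assms(1,2)] assms(3,4)]
    by (auto simp: weval_restrict)
qed

lemma satisfies_epi:
  assumes "is_semigroup S" "is_semigroup T" "h \<in> epi S T" "u \<noteq> []" "v \<noteq> []" "satisfies S u v"
  shows "satisfies T u v"
proof -
  have h: "h \<in> hom S T" "h ` carrier S = carrier T" using assms(3) by (auto simp: epi_def)
  have "weval T f u = weval T f v" if f: "range f \<subseteq> carrier T" for f
  proof -
    have "\<exists>b. \<forall>x. b x \<in> carrier S \<and> h (b x) = f x"
    proof (rule choice, rule allI)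
      fix x
      have "f x \<in> h ` carrier S" using f h(2) by auto
      then show "\<exists>y. y \<in> carrier S \<and> h y = f x" by auto
    qed
    then obtain b where b: "\<And>x. b x \<in> carrier S" "h \<circ> b = f" by (metis comp_def ext)
    have "weval S b u = weval S b v"
      using assms(6) b(1) unfolding satisfies_iff[OF assms(1,4,5)] by blast
    then show ?thesis
      using hom_weval[OF h(1) assms(1,4), of b] hom_weval[OF h(1) assms(1,5), of b] b by simp
  qed
  then show ?thesis using satisfies_iff[OF assms(2,4,5)] by blast
qed

lemma image_of_sub_of_power_satisfies:
  assumes "is_semigroup S" "is_semigroup T" "image_of_sub_of_power I S T"
    and "u \<noteq> []" "v \<noteq> []" "satisfies S u v"
  shows "satisfies T u v"
proof -
  let ?P = "product_group I (\<lambda>_. S)"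
  obtain B h where B: "subsemigroup B ?P" and h: "h \<in> epi (?P\<lparr>carrier := B\<rparr>) T"
    using assms(3) unfolding image_of_sub_of_power_def by blast
  have P: "is_semigroup ?P" using assms(1) by (intro is_semigroup_product)
  have "satisfies ?P u v" using assms by (intro satisfies_product)
  then have "satisfies (?P\<lparr>carrier := B\<rparr>) u v" using satisfies_sub[OF P B] assms by blast
  then show ?thesis using satisfies_epi[OF is_semigroup_sub[OF P B] assms(2) h] assms by blast
qed

lemma in_var_if_identities:
  fixes S :: "'s monoid" and T :: "'t monoid"
  assumes S: "is_semigroup S" and T: "is_semigroup T"
    and ids: "\<And>u v :: 'a::infinite list. u \<noteq> [] \<Longrightarrow> v \<noteq> [] \<Longrightarrow> satisfies S u v \<Longrightarrow> satisfies T u v"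
  shows "in_var S T"
proof -
  define I :: "('t \<Rightarrow> 's) set" where "I = {f. range f \<subseteq> carrier S}"
  let ?P = "product_group I (\<lambda>_. S)"
  define q where "q t = (\<lambda>f\<in>I. f t)" for t :: 't
  define L where "L = {w. w \<noteq> [] \<and> set w \<subseteq> carrier T}"
  define B where "B = weval ?P q ` L"
  define h where "h b = weval T id (SOME w. w \<in> L \<and> weval ?P q w = b)" for b
  have P: "is_semigroup ?P" using S by (intro is_semigroup_product)
  have q: "q t \<in> carrier ?P" for t by (auto simp: q_def I_def)
  have key: "weval T id w = weval T id w'"
    if w: "w \<in> L" "w' \<in> L" and eq: "weval ?P q w = weval ?P q w'" for w w'
  proof -
    define X where "X = set w \<union> set w'"
    have "finite X" by (simp add: X_def)
    then obtain g :: "'t \<Rightarrow> 'a" where g: "inj_on g X"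
      using arb_inj_on_finite_infinite by blast
    have ne: "w \<noteq> []" "w' \<noteq> []" "map g w \<noteq> []" "map g w' \<noteq> []" using w by (auto simp: L_def)
    have "weval S F (map g w) = weval S F (map g w')" if F: "range F \<subseteq> carrier S" for F
    proof -
      have FI: "F \<circ> g \<in> I" using F by (auto simp: I_def)
      have "weval S (F \<circ> g) w = weval S (F \<circ> g) w'"
        using arg_cong[OF eq, of "\<lambda>p. p (F \<circ> g)"] FI ne
        by (simp add: weval_product q_def comp_def)
      then show ?thesis by (simp add: weval_map)
    qed
    then have "satisfies S (map g w) (map g w')" using satisfies_iff[OF S ne(3,4)] by blast
    then have sat: "satisfies T (map g w) (map g w')" using ids ne by blast
    obtain t0 where t0: "t0 \<in> carrier T" using T by (auto simp: is_semigroup_def)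
    define F where "F a = (if a \<in> g ` X then inv_into X g a else t0)" for a
    have "X \<subseteq> carrier T" using w by (auto simp: L_def X_def)
    then have "range F \<subseteq> carrier T" using t0 by (auto simp: F_def inv_into_into subset_iff)
    then have "weval T (F \<circ> g) w = weval T (F \<circ> g) w'"
      using sat unfolding satisfies_iff[OF T ne(3,4)] by (simp add: weval_map)
    moreover have "weval T (F \<circ> g) w = weval T id w" "weval T (F \<circ> g) w' = weval T id w'"
      using g by (auto intro!: weval_cong simp: F_def X_def)
    ultimately show ?thesis by simp
  qed
  have h: "h (weval ?P q w) = weval T id w" if "w \<in> L" for w
  proof -
    have "(SOME w'. w' \<in> L \<and> weval ?P q w' = weval ?P q w) \<in> L \<and>
       weval ?P q (SOME w'. w' \<in> L \<and> weval ?P q w' = weval ?P q w) = weval ?P q w"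
      by (rule someI[of _ w]) (use that in simp)
    then show ?thesis using key that unfolding h_def by blast
  qed
  have app: "u @ v \<in> L" "weval ?P q u \<otimes>\<^bsub>?P\<^esub> weval ?P q v = weval ?P q (u @ v)"
     "weval T id u \<otimes>\<^bsub>T\<^esub> weval T id v = weval T id (u @ v)" if "u \<in> L" "v \<in> L" for u v
  proof -
    show "u @ v \<in> L" using that by (auto simp: L_def)
    show "weval ?P q u \<otimes>\<^bsub>?P\<^esub> weval ?P q v = weval ?P q (u @ v)"
      using that q by (intro weval_append[OF P, symmetric]) (auto simp: L_def)
    show "weval T id u \<otimes>\<^bsub>T\<^esub> weval T id v = weval T id (u @ v)"
      using that by (intro weval_append[OF T, symmetric]) (auto simp: L_def)
  qed
  have letter: "[t] \<in> L" if "t \<in> carrier T" for t using that by (simp add: L_def)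
  have ev: "weval T id w \<in> carrier T" if "w \<in> L" for w
    using that by (intro weval_in_carrier[OF T]) (auto simp: L_def)
  have "subsemigroup B ?P"
    unfolding subsemigroup_def
  proof (intro conjI ballI)
    show "B \<noteq> {}" using letter T by (auto simp: B_def is_semigroup_def)
    show "B \<subseteq> carrier ?P"
      using weval_in_carrier[OF P _ q] by (auto simp: B_def L_def simp del: carrier_product_group)
    fix x y assume "x \<in> B" "y \<in> B"
    then obtain u v where uv: "u \<in> L" "x = weval ?P q u" "v \<in> L" "y = weval ?P q v"
      by (auto simp: B_def)
    then have "x \<otimes>\<^bsub>?P\<^esub> y = weval ?P q (u @ v)" using app(2)[of u v] by simp
    then show "x \<otimes>\<^bsub>?P\<^esub> y \<in> B" using app(1)[of u v] uv unfolding B_def by blast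
  qed
  moreover have "h \<in> epi (?P\<lparr>carrier := B\<rparr>) T"
  proof -
    have "h (x \<otimes>\<^bsub>?P\<^esub> y) = h x \<otimes>\<^bsub>T\<^esub> h y" if xy: "x \<in> B" "y \<in> B" for x y
    proof -
      obtain u v where uv: "u \<in> L" "x = weval ?P q u" "v \<in> L" "y = weval ?P q v"
        using xy by (auto simp: B_def)
      have "h (x \<otimes>\<^bsub>?P\<^esub> y) = h (weval ?P q (u @ v))" using app(2)[of u v] uv by simp
      also have "\<dots> = weval T id (u @ v)" using uv app(1) by (intro h) auto
      also have "\<dots> = h x \<otimes>\<^bsub>T\<^esub> h y" using app(3)[of u v] uv h by simp
      finally show ?thesis .
    qed
    moreover have "h ` B = carrier T"
    proof
      show "h ` B \<subseteq> carrier T" using h ev by (auto simp: B_def)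
      show "carrier T \<subseteq> h ` B"
      proof
        fix t assume t: "t \<in> carrier T"
        have "t = h (weval ?P q [t])" using h[OF letter[OF t]] by simp
        then show "t \<in> h ` B" using letter[OF t] unfolding B_def by blast
      qed
    qed
    ultimately show ?thesis
      unfolding epi_def hom_def by (auto simp del: carrier_product_group mult_product_group)
  qed
  ultimately show ?thesis unfolding in_var_def image_of_sub_of_power_def by blast
qed

theorem in_var_iff_identities:
  assumes "is_semigroup S" "is_semigroup T"
  shows "in_var S T \<longleftrightarrow>
    (\<forall>u v :: 'a::infinite list. u \<noteq> [] \<longrightarrow> v \<noteq> [] \<longrightarrow> satisfies S u v \<longrightarrow> satisfies T u v)"
  using image_of_sub_of_power_satisfies[OF assms] in_var_if_identities[OF assms]
  unfolding in_var_def by metis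

theorem in_varI:
  fixes I :: "'i set"
  assumes "is_semigroup S" "is_semigroup T" "image_of_sub_of_power I S T"
  shows "in_var S T"
  by (rule in_var_if_identities[where 'a = nat, OF assms(1,2)])
     (rule image_of_sub_of_power_satisfies[OF assms])

theorem in_var_self: "is_semigroup S \<Longrightarrow> in_var S S"
  by (simp add: in_var_iff_identities[where 'a = nat])

theorem in_var_epi:
  assumes "is_semigroup S" "is_semigroup T" "is_semigroup U" "in_var S T" "h \<in> epi T U"
  shows "in_var S U"
proof (rule in_var_if_identities[where 'a = nat, OF assms(1,3)])
  fix u v :: "nat list" assume uv: "u \<noteq> []" "v \<noteq> []" "satisfies S u v"
  then have "satisfies T u v"
    using in_var_iff_identities[where 'a = nat, OF assms(1,2)] assms(4) by simp
  then show "satisfies U u v" by (rule satisfies_epi[OF assms(2,3,5) uv(1,2)])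
qed

theorem in_var_sub:
  assumes "is_semigroup S" "is_semigroup T" "in_var S T" "subsemigroup B T"
  shows "in_var S (T\<lparr>carrier := B\<rparr>)"
proof (rule in_var_if_identities[where 'a = nat, OF assms(1) is_semigroup_sub[OF assms(2,4)]])
  fix u v :: "nat list" assume uv: "u \<noteq> []" "v \<noteq> []" "satisfies S u v"
  then have "satisfies T u v"
    using in_var_iff_identities[where 'a = nat, OF assms(1,2)] assms(3) by simp
  then show "satisfies (T\<lparr>carrier := B\<rparr>) u v" by (rule satisfies_sub[OF assms(2,4) uv(1,2)])
qed

theorem in_var_product:
  assumes "is_semigroup S" "\<And>i. i \<in> I \<Longrightarrow> is_semigroup (T i)" "\<And>i. i \<in> I \<Longrightarrow> in_var S (T i)"
  shows "in_var S (product_group I T)"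
proof (rule in_var_if_identities[where 'a = nat, OF assms(1) is_semigroup_product])
  fix u v :: "nat list" assume uv: "u \<noteq> []" "v \<noteq> []" "satisfies S u v"
  have "satisfies (T i) u v" if "i \<in> I" for i
    using in_var_iff_identities[where 'a = nat, OF assms(1,2)] assms(3) that uv by simp
  then show "satisfies (product_group I T) u v"
    using assms(2) uv by (intro satisfies_product)
qed (rule assms(2))

end

theory Submission
  imports Defs
begin

text \<open>
  Write \<open>P\<close> for \<open>S_of \<tau> W\<close> or \<open>S1_of \<tau> W\<close>. By Birkhoff's theorem (\<open>in_var_iff_identities\<close>) the
  claim is that every identity of \<open>S\<close> holds in \<open>P\<close> iff the words in \<open>W\<close> are \<open>\<tau>\<close>-terms for \<open>S\<close>.
  The only thing to know about \<open>P\<close> is that it is the image of the words (including the empty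
  word in the monoid case) under a homomorphism \<open>p\<close> that identifies two different words
  iff they are \<open>\<tau>\<close>-related or are both non-empty words outside \<open>W\<close>; this is
  \<open>epi_S_of\<close> and \<open>epi_S1_of\<close>.

  If \<open>P\<close> satisfies the identities of \<open>S\<close>, and \<open>S\<close> satisfies \<open>w \<approx> v\<close> with \<open>w \<in> W\<close>, then
  \<open>p w = p v\<close>, which means that \<open>w\<close> and \<open>v\<close> are \<open>\<tau>\<close>-related. Conversely, let \<open>S\<close> satisfy \<open>u \<approx> v\<close>. An assignment
  of values in \<open>P\<close> lifts along \<open>p\<close> to a substitution of words for letters, under which \<open>u\<close>, \<open>v\<close>
  become words \<open>U\<close>, \<open>V\<close>, and \<open>S\<close> satisfies \<open>U \<approx> V\<close> as well. If one of them is in \<open>W\<close>,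
  they are \<open>\<tau>\<close>-related because it is a \<open>\<tau>\<close>-term; otherwise both are collapsed to zero. In either
  case \<open>p U = p V\<close>, which is the required equality of values (\<open>in_var_iff_tau_terms\<close>).

  In the monoid case letters may be erased, and the argument must exclude that exactly one of
  \<open>U\<close> and \<open>V\<close> is empty. If it were so, then \<open>S\<close> would satisfy \<open>t\<^sup>k \<approx> 1\<close> and hence
  \<open>x \<approx> x t\<^sup>k\<close>, for a letter \<open>x\<close> in \<open>W\<close>, a letter \<open>t \<noteq> x\<close> and some \<open>k > 0\<close>. As \<open>x\<close> is a
  \<open>\<tau>\<close>-term, it would be \<open>\<tau>\<close>-related to a word that is not a power of \<open>x\<close>
  (\<open>no_word_is_identity\<close>).
\<close>

section \<open>Homomorphic images and Rees quotients\<close>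

lemma is_semigroup_epi_image:
  assumes "is_semigroup S" "h \<in> epi S T"
  shows "is_semigroup T"
proof -
  have m: "h (x \<otimes>\<^bsub>S\<^esub> y) = h x \<otimes>\<^bsub>T\<^esub> h y" if "x \<in> carrier S" "y \<in> carrier S" for x y
    using assms(2) that by (auto simp: epi_def hom_def)
  have T: "carrier T = h ` carrier S" using assms(2) by (auto simp: epi_def)
  have S: "carrier S \<noteq> {}"
    "\<And>x y. x \<in> carrier S \<Longrightarrow> y \<in> carrier S \<Longrightarrow> x \<otimes>\<^bsub>S\<^esub> y \<in> carrier S"
    "\<And>x y z. x \<in> carrier S \<Longrightarrow> y \<in> carrier S \<Longrightarrow> z \<in> carrier S \<Longrightarrow>
        (x \<otimes>\<^bsub>S\<^esub> y) \<otimes>\<^bsub>S\<^esub> z = x \<otimes>\<^bsub>S\<^esub> (y \<otimes>\<^bsub>S\<^esub> z)"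
    using assms(1) by (auto simp: is_semigroup_def)
  show ?thesis
    unfolding is_semigroup_def T using S by (auto simp flip: m)
qed

lemma is_semigroup_monoid: "monoid S \<Longrightarrow> is_semigroup S"
  unfolding is_semigroup_def
  by (auto intro: monoid.m_closed monoid.one_closed simp: monoid.m_assoc)

lemma epi_quotient:
  assumes S: "is_semigroup S" and r: "congruence_on S r"
  shows "(\<lambda>x. r `` {x}) \<in> epi S (quotient_semigroup S r)"
proof -
  have eq: "equiv (carrier S) r"
    and c: "\<And>x x' y y'. (x, x') \<in> r \<Longrightarrow> (y, y') \<in> r \<Longrightarrow> (x \<otimes>\<^bsub>S\<^esub> y, x' \<otimes>\<^bsub>S\<^esub> y') \<in> r"
    using r by (auto simp: congruence_on_def)
  have mult: "r `` {x \<otimes>\<^bsub>S\<^esub> y} = (\<Union>x'\<in>r `` {x}. \<Union>y'\<in>r `` {y}. r `` {x' \<otimes>\<^bsub>S\<^esub> y'})"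
    if "x \<in> carrier S" "y \<in> carrier S" for x y
  proof -
    have "r `` {x' \<otimes>\<^bsub>S\<^esub> y'} = r `` {x \<otimes>\<^bsub>S\<^esub> y}" if "x' \<in> r `` {x}" "y' \<in> r `` {y}" for x' y'
      using that c equiv_class_eq[OF eq] by (metis Image_singleton_iff)
    moreover have "x \<in> r `` {x}" "y \<in> r `` {y}"
      using that eq equiv_class_self by fastforce+
    ultimately show ?thesis by blast
  qed
  show ?thesis
    unfolding epi_def hom_def quotient_semigroup_def
    by (auto simp: mult quotientI) (auto simp: quotient_def)
qed

definition semigroup_ideal :: "'s set \<Rightarrow> 's monoid \<Rightarrow> bool" where
  "semigroup_ideal J S \<longleftrightarrow> J \<subseteq> carrier S \<and>
     (\<forall>x\<in>J. \<forall>y\<in>carrier S. x \<otimes>\<^bsub>S\<^esub> y \<in> J \<and> y \<otimes>\<^bsub>S\<^esub> x \<in> J)"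

lemma semigroup_ideal_epi_image:
  assumes "h \<in> epi S T" "semigroup_ideal J S"
  shows "semigroup_ideal (h ` J) T"
proof -
  have m: "h (x \<otimes>\<^bsub>S\<^esub> y) = h x \<otimes>\<^bsub>T\<^esub> h y" if "x \<in> carrier S" "y \<in> carrier S" for x y
    using assms(1) that by (auto simp: epi_def hom_def)
  have T: "carrier T = h ` carrier S" using assms(1) by (auto simp: epi_def)
  have "J \<subseteq> carrier S" using assms(2) by (simp add: semigroup_ideal_def)
  then show ?thesis
    using assms(2) unfolding semigroup_ideal_def T by (auto simp: subset_iff simp flip: m)
qed

lemma congruence_on_rees:
  assumes "is_semigroup S" "semigroup_ideal J S"
  shows "congruence_on S (rees_congruence S J)"
proof -
  have "J \<subseteq> carrier S" using assms(2) by (simp add: semigroup_ideal_def)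
  then have "equiv (carrier S) (rees_congruence S J)"
    by (auto simp: rees_congruence_def equiv_def refl_on_def sym_def trans_def)
  then show ?thesis
    using assms by (auto simp: congruence_on_def rees_congruence_def is_semigroup_def
        semigroup_ideal_def subset_iff)
qed

text \<open>
  The Rees quotient of an image \<open>h(F)\<close> over the image of an ideal \<open>K\<close> is itself an image of \<open>F\<close>. Saturation
  of \<open>K\<close> is what makes \<open>h x \<in> h(K)\<close> equivalent to \<open>x \<in> K\<close>, so that the kernel can be
  described in \<open>F\<close>.
\<close>

lemma epi_rees_quotient:
  assumes F: "is_semigroup F" and h: "h \<in> epi F T" and K: "semigroup_ideal K F"
    and sat: "\<forall>x\<in>K. \<forall>y\<in>carrier F. h x = h y \<longrightarrow> y \<in> K"
  obtains p where "p \<in> epi F (rees_quotient T (h ` K))"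
    "\<forall>x\<in>carrier F. \<forall>y\<in>carrier F. p x = p y \<longleftrightarrow> h x = h y \<or> x \<in> K \<and> y \<in> K"
proof -
  define r where "r = rees_congruence T (h ` K)"
  have T: "is_semigroup T" using F h by (rule is_semigroup_epi_image)
  have c: "congruence_on T r"
    unfolding r_def using T h K by (intro congruence_on_rees semigroup_ideal_epi_image)
  have q: "(\<lambda>x. r `` {x}) \<in> epi T (rees_quotient T (h ` K))"
    using epi_quotient[OF T c] by (simp add: rees_quotient_def r_def)
  have hT: "h x \<in> carrier T" if "x \<in> carrier F" for x
    using h that by (auto simp: epi_def hom_def)
  have "carrier (rees_quotient T (h ` K)) = (\<lambda>x. r `` {h x}) ` carrier F"
    using h q by (simp add: epi_def image_image flip: image_image[of "\<lambda>x. r `` {x}" h])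
  then have "(\<lambda>x. r `` {h x}) \<in> epi F (rees_quotient T (h ` K))"
    using h q by (simp add: epi_def hom_def Pi_iff)
  moreover have "r `` {h x} = r `` {h y} \<longleftrightarrow> h x = h y \<or> x \<in> K \<and> y \<in> K"
    if "x \<in> carrier F" "y \<in> carrier F" for x y
  proof -
    have "r `` {h x} = r `` {h y} \<longleftrightarrow> (h x, h y) \<in> r"
      using c that hT by (intro eq_equiv_class_iff) (auto simp: congruence_on_def)
    also have "\<dots> \<longleftrightarrow> h x = h y \<or> h x \<in> h ` K \<and> h y \<in> h ` K"
      using that hT by (auto simp: r_def rees_congruence_def)
    also have "\<dots> \<longleftrightarrow> h x = h y \<or> x \<in> K \<and> y \<in> K"
      using sat that by (metis image_iff)
    finally show ?thesis .
  qed
  ultimately show ?thesis using that by simp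
qed

section \<open>The semigroup and the monoid of a set of words as images of words\<close>

definition free_monoid :: "'a list monoid" where
  "free_monoid = \<lparr>carrier = UNIV, mult = (@), one = []\<rparr>"

lemma free_semigroup_simps [simp]:
  "w \<in> carrier free_semigroup \<longleftrightarrow> w \<noteq> []" "u \<otimes>\<^bsub>free_semigroup\<^esub> v = u @ v"
  by (simp_all add: free_semigroup_def)

lemma free_monoid_simps [simp]:
  "carrier free_monoid = UNIV" "u \<otimes>\<^bsub>free_monoid\<^esub> v = u @ v"
  by (simp_all add: free_monoid_def)

lemma is_semigroup_free_semigroup: "is_semigroup free_semigroup"
  by (auto simp: is_semigroup_def free_semigroup_def intro: exI[of _ "[undefined]"])

lemma is_semigroup_free_monoid: "is_semigroup free_monoid"
  by (auto simp: is_semigroup_def)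

lemma non_words_append:
  assumes "subword_closed W" "u \<in> non_words W"
  shows "u @ v \<in> non_words W" "v @ u \<in> non_words W"
proof -
  have "sublist u (u @ v)" "sublist u (v @ u)" by auto
  then show "u @ v \<in> non_words W" "v @ u \<in> non_words W"
    using assms unfolding non_words_def subword_closed_def by auto
qed

lemma nat_hom_epi:
  assumes "congruence_on free_semigroup \<tau>"
  shows "nat_hom \<tau> \<in> epi free_semigroup (quotient_semigroup free_semigroup \<tau>)"
  using epi_quotient[OF is_semigroup_free_semigroup assms] by (simp add: nat_hom_def[abs_def])

lemma nat_hom1_epi:
  assumes "congruence_on free_semigroup \<tau>"
  shows "nat_hom1 \<tau> \<in> epi free_monoid (adjoin_one (quotient_semigroup free_semigroup \<tau>))"
proof -
  let ?Q = "quotient_semigroup free_semigroup \<tau>"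
  have car: "carrier ?Q = nat_hom \<tau> ` {w. w \<noteq> []}"
    using nat_hom_epi[OF assms] by (auto simp: epi_def free_semigroup_def)
  have m: "nat_hom \<tau> (u @ v) = nat_hom \<tau> u \<otimes>\<^bsub>?Q\<^esub> nat_hom \<tau> v" if "u \<noteq> []" "v \<noteq> []" for u v
    using nat_hom_epi[OF assms] that by (simp add: epi_def hom_def)
  show ?thesis
    unfolding epi_def hom_def
    by (auto simp: adjoin_one_def nat_hom1_def car m image_iff split: if_splits)
qed

lemma nat_hom_eq_iff:
  assumes "congruence_on free_semigroup \<tau>" "u \<noteq> []" "v \<noteq> []"
  shows "nat_hom \<tau> u = nat_hom \<tau> v \<longleftrightarrow> (u, v) \<in> \<tau>"
  unfolding nat_hom_def using assms
  by (intro eq_equiv_class_iff[of "carrier free_semigroup"]) (auto simp: congruence_on_def)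

lemma tau_properties:
  assumes "congruence_on free_semigroup \<tau>"
  shows tau_nonempty: "(u, v) \<in> \<tau> \<Longrightarrow> u \<noteq> [] \<and> v \<noteq> []"
    and tau_sym: "(u, v) \<in> \<tau> \<Longrightarrow> (v, u) \<in> \<tau>"
    and tau_refl: "u \<noteq> [] \<Longrightarrow> (u, u) \<in> \<tau>"
proof -
  have e: "equiv (carrier free_semigroup) \<tau>" using assms by (simp add: congruence_on_def)
  show "(u, v) \<in> \<tau> \<Longrightarrow> u \<noteq> [] \<and> v \<noteq> []"
    using equiv_class_eq_iff[OF e, of u v] by simp
  show "(u, v) \<in> \<tau> \<Longrightarrow> (v, u) \<in> \<tau>" using e by (auto simp: equiv_def sym_def)
  show "u \<noteq> [] \<Longrightarrow> (u, u) \<in> \<tau>" using e by (auto simp: equiv_def refl_on_def)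
qed

lemma non_words_saturated:
  assumes "congruence_on free_semigroup \<tau>" "union_of_classes \<tau> W"
    and "u \<in> non_words W" "(u, v) \<in> \<tau>"
  shows "v \<in> non_words W"
  using assms tau_sym[OF assms(1)] tau_nonempty[OF assms(1)]
  by (auto simp: non_words_def union_of_classes_def)

lemma epi_S_of:
  assumes c: "congruence_on free_semigroup \<tau>" and "union_of_classes \<tau> W" "subword_closed W"
  obtains p where "p \<in> epi free_semigroup (S_of \<tau> W)"
    "\<forall>u\<in>carrier free_semigroup. \<forall>v\<in>carrier free_semigroup.
       p u = p v \<longleftrightarrow> u = v \<or> (u, v) \<in> \<tau> \<or> u \<in> non_words W \<and> v \<in> non_words W"
proof -
  have K: "semigroup_ideal (non_words W) free_semigroup"
    using non_words_append[OF assms(3)] by (auto simp: semigroup_ideal_def non_words_def)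
  have "v \<in> non_words W"
    if "u \<in> non_words W" "v \<in> carrier free_semigroup" "nat_hom \<tau> u = nat_hom \<tau> v" for u v
    using that nat_hom_eq_iff[OF c, of u v]
    by (intro non_words_saturated[OF assms(1,2) that(1)]) (auto simp: non_words_def)
  then have sat: "\<forall>u\<in>non_words W. \<forall>v\<in>carrier free_semigroup.
      nat_hom \<tau> u = nat_hom \<tau> v \<longrightarrow> v \<in> non_words W"
    by blast
  obtain p where "p \<in> epi free_semigroup (S_of \<tau> W)"
    "\<forall>u\<in>carrier free_semigroup. \<forall>v\<in>carrier free_semigroup.
       p u = p v \<longleftrightarrow> nat_hom \<tau> u = nat_hom \<tau> v \<or> u \<in> non_words W \<and> v \<in> non_words W"
    using epi_rees_quotient[OF is_semigroup_free_semigroup nat_hom_epi[OF c] K sat]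
    unfolding S_of_def by blast
  then show ?thesis using that[of p] nat_hom_eq_iff[OF c] tau_refl[OF c] by auto
qed

lemma epi_S1_of:
  assumes c: "congruence_on free_semigroup \<tau>" and "union_of_classes \<tau> W" "subword_closed W"
  obtains p where "p \<in> epi free_monoid (S1_of \<tau> W)"
    "\<forall>u\<in>carrier free_monoid. \<forall>v\<in>carrier free_monoid.
       p u = p v \<longleftrightarrow> u = v \<or> (u, v) \<in> \<tau> \<or> u \<in> non_words W \<and> v \<in> non_words W"
proof -
  have K: "semigroup_ideal (non_words W) free_monoid"
    using non_words_append[OF assms(3)] by (auto simp: semigroup_ideal_def)
  have ker: "nat_hom1 \<tau> u = nat_hom1 \<tau> v \<longleftrightarrow> u = v \<or> (u, v) \<in> \<tau>" for u v
    using nat_hom_eq_iff[OF c, of u v] tau_nonempty[OF c, of u v] by (auto simp: nat_hom1_def)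
  have "v \<in> non_words W"
    if "u \<in> non_words W" "v \<in> carrier free_monoid" "nat_hom1 \<tau> u = nat_hom1 \<tau> v" for u v
    using that ker non_words_saturated[OF assms(1,2) that(1)] by auto
  then have sat: "\<forall>u\<in>non_words W. \<forall>v\<in>carrier free_monoid.
      nat_hom1 \<tau> u = nat_hom1 \<tau> v \<longrightarrow> v \<in> non_words W"
    by blast
  obtain p where "p \<in> epi free_monoid (S1_of \<tau> W)"
    "\<forall>u\<in>carrier free_monoid. \<forall>v\<in>carrier free_monoid.
       p u = p v \<longleftrightarrow> nat_hom1 \<tau> u = nat_hom1 \<tau> v \<or> u \<in> non_words W \<and> v \<in> non_words W"
    using epi_rees_quotient[OF is_semigroup_free_monoid nat_hom1_epi[OF c] K sat]
    unfolding S1_of_def by blast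
  then show ?thesis using that[of p] ker by auto
qed

section \<open>Substituting words for letters\<close>

lemma weval_words:
  assumes "mult F = (@)" "w \<noteq> []"
  shows "weval F \<phi> w = concat (map \<phi> w)"
  using assms(2) by (induction w rule: list_nonempty_induct) (auto simp: weval_Cons assms(1))

lemma hom_subst:
  assumes "is_semigroup F" "mult F = (@)" "h \<in> hom F T" "\<forall>x. \<phi> x \<in> carrier F" "w \<noteq> []"
  shows "h (concat (map \<phi> w)) = weval T (h \<circ> \<phi>) w"
  using hom_weval[OF assms(3,1,5), of \<phi>] assms(4) weval_words[OF assms(2,5)] by simp

lemma satisfies_subst:
  fixes S :: "'s monoid" and \<phi> :: "'a \<Rightarrow> 'b list"
  assumes S: "is_semigroup S" and ne: "u \<noteq> []" "v \<noteq> []" "\<forall>x. \<phi> x \<noteq> []"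
    and sat: "satisfies S u v"
  shows "satisfies S (concat (map \<phi> u)) (concat (map \<phi> v))"
  unfolding satisfies_def
proof
  fix \<Theta> :: "'b list \<Rightarrow> 's" assume \<Theta>: "\<Theta> \<in> hom free_semigroup S"
  have eq: "\<Theta> (concat (map \<phi> w)) = weval S (\<Theta> \<circ> \<phi>) w" if "w \<noteq> []" for w
    using that ne(3) \<Theta> is_semigroup_free_semigroup
    by (intro hom_subst) (auto simp: free_semigroup_def)
  have "range (\<Theta> \<circ> \<phi>) \<subseteq> carrier S" using \<Theta> ne(3) by (auto simp: hom_def Pi_iff)
  then have "weval S (\<Theta> \<circ> \<phi>) u = weval S (\<Theta> \<circ> \<phi>) v"
    using sat unfolding satisfies_iff[OF S ne(1,2)] by blast
  then show "\<Theta> (concat (map \<phi> u)) = \<Theta> (concat (map \<phi> v))" using eq ne by simp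
qed

text \<open>
  Evaluation by \<open>weval\<close> is unspecified on the empty word; a monoid has a value for it,
  and with that value evaluation is a homomorphism on all words.
\<close>

definition weval1 :: "'s monoid \<Rightarrow> ('a \<Rightarrow> 's) \<Rightarrow> 'a list \<Rightarrow> 's" where
  "weval1 S f w = (if w = [] then \<one>\<^bsub>S\<^esub> else weval S f w)"

lemma weval1_hom:
  assumes "monoid S" "range f \<subseteq> carrier S"
  shows "weval1 S f \<in> hom free_monoid S"
proof -
  have S: "is_semigroup S" using assms(1) by (rule is_semigroup_monoid)
  have "weval S f w \<in> carrier S" if "w \<noteq> []" for w
    using that assms(2) by (intro weval_in_carrier[OF S]) auto
  moreover have "weval S f (u @ v) = weval S f u \<otimes>\<^bsub>S\<^esub> weval S f v" if "u \<noteq> []" "v \<noteq> []" for u v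
    using that assms(2) by (intro weval_append[OF S]) auto
  ultimately show ?thesis
    using assms(1) by (auto simp: hom_def weval1_def intro: monoid.one_closed monoid.l_one
        monoid.r_one simp: monoid.l_one monoid.r_one)
qed

lemma weval1_subst_eq:
  assumes S: "monoid S" and ne: "u \<noteq> []" "v \<noteq> []" and sat: "satisfies S u v"
    and f: "range f \<subseteq> carrier S"
  shows "weval1 S f (concat (map \<phi> u)) = weval1 S f (concat (map \<phi> v))"
proof -
  have hom: "weval1 S f \<in> hom free_monoid S" using S f by (rule weval1_hom)
  have eq: "weval1 S f (concat (map \<phi> w)) = weval S (weval1 S f \<circ> \<phi>) w" if "w \<noteq> []" for w
    using that hom is_semigroup_free_monoid by (intro hom_subst) (auto simp: free_monoid_def)
  have "range (weval1 S f \<circ> \<phi>) \<subseteq> carrier S" using hom by (auto simp: hom_def Pi_iff)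
  then have "weval S (weval1 S f \<circ> \<phi>) u = weval S (weval1 S f \<circ> \<phi>) v"
    using sat unfolding satisfies_iff[OF is_semigroup_monoid[OF S] ne] by blast
  then show ?thesis using eq ne by simp
qed

text \<open>
  If \<open>w\<close> had the value \<open>1\<close> under every assignment, renaming all its letters to some \<open>t \<noteq> x\<close> gives a power \<open>t\<^sup>k\<close>, \<open>k > 0\<close>, with value
  \<open>1\<close> throughout \<open>S\<close>, so that \<open>S\<close> satisfies \<open>x \<approx> x t\<^sup>k\<close>.
\<close>

lemma no_word_is_identity:
  fixes x :: "'a::infinite"
  assumes S: "monoid S" and x: "tau_term \<tau> S [x]"
    and pow: "\<forall>u. ([x], u) \<in> \<tau> \<longrightarrow> (\<exists>m>0. u = replicate m x)" and w: "w \<noteq> []"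
  shows "\<exists>f :: 'a \<Rightarrow> 's. range f \<subseteq> carrier S \<and> weval S f w \<noteq> \<one>\<^bsub>S\<^esub>"
proof (rule ccontr)
  assume "\<not> ?thesis"
  then have one: "weval S f w = \<one>\<^bsub>S\<^esub>" if "range f \<subseteq> carrier S" for f :: "'a \<Rightarrow> 's"
    using that by blast
  obtain t :: 'a where t: "t \<noteq> x"
    using ex_new_if_finite[OF infinite_UNIV, of "{x}"] by auto
  define z where "z = map (\<lambda>_. t) w"
  have z: "z \<noteq> []" using w by (simp add: z_def)
  have "weval S f [x] = weval S f (x # z)" if f: "range f \<subseteq> carrier S" for f
  proof -
    have "weval S f z = weval S (f \<circ> (\<lambda>_. t)) w" by (simp add: z_def weval_map)
    also have "\<dots> = \<one>\<^bsub>S\<^esub>" using f by (intro one) auto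
    finally show ?thesis
      using f S z by (simp add: weval_Cons monoid.r_one range_subsetD)
  qed
  then have "satisfies S [x] (x # z)"
    using satisfies_iff[OF is_semigroup_monoid[OF S], of "[x]" "x # z"] by simp
  then have "([x], x # z) \<in> \<tau>" using x by (simp add: tau_term_def)
  then obtain m where m: "x # z = replicate m x" using pow by blast
  have "t \<in> set (x # z)" using w by (simp add: z_def image_constant_conv)
  then show False unfolding m using t by (simp split: if_splits)
qed

lemma satisfies_subst_monoid:
  fixes \<phi> :: "'a::infinite \<Rightarrow> 'a list" and S :: "'s monoid" and x :: 'a
  assumes S: "monoid S" and ne: "u \<noteq> []" "v \<noteq> []" and sat: "satisfies S u v"
    and x: "tau_term \<tau> S [x]" and pow: "\<forall>u. ([x], u) \<in> \<tau> \<longrightarrow> (\<exists>m>0. u = replicate m x)"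
  defines "U \<equiv> concat (map \<phi> u)" and "V \<equiv> concat (map \<phi> v)"
  shows "U = V \<or> U \<noteq> [] \<and> V \<noteq> [] \<and> satisfies S U V"
proof -
  have eq: "weval1 S f U = weval1 S f V" if "range f \<subseteq> carrier S" for f
    unfolding U_def V_def using S ne sat that by (rule weval1_subst_eq)
  have "U = [] \<longleftrightarrow> V = []"
  proof (rule ccontr)
    assume "(U = []) \<noteq> (V = [])"
    then obtain w where w: "w \<noteq> []" "U = [] \<and> V = w \<or> U = w \<and> V = []" by metis
    have "weval S f w = \<one>\<^bsub>S\<^esub>" if "range f \<subseteq> carrier S" for f
      using eq[OF that] w by (auto simp: weval1_def)
    then show False using no_word_is_identity[OF S x pow w(1)] by blast
  qed
  moreover have "satisfies S U V" if "U \<noteq> []" "V \<noteq> []"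
    using eq that unfolding satisfies_iff[OF is_semigroup_monoid[OF S] that]
    by (simp add: weval1_def)
  ultimately show ?thesis by metis
qed

section \<open>The varieties that contain the quotient\<close>

text \<open>
  The common argument for semigroups and monoids. The two cases differ in the words \<open>F\<close> that
  represent elements, and therefore in the reason for the last assumption: a substitution of
  words in \<open>F\<close> for letters turns an identity of \<open>S\<close> into an identity of \<open>S\<close> between non-empty
  words, unless both sides become equal (for \<open>free_monoid\<close>, possibly both empty).
\<close>

lemma in_var_iff_tau_terms:
  fixes F :: "'a::infinite list monoid" and S :: "'s monoid" and T :: "'t monoid"
  assumes S: "is_semigroup S" and F: "is_semigroup F" "mult F = (@)"
    and all_words: "carrier free_semigroup \<subseteq> carrier F"
    and p: "p \<in> epi F T"
    and ker: "\<forall>u\<in>carrier F. \<forall>v\<in>carrier F.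
       p u = p v \<longleftrightarrow> u = v \<or> (u, v) \<in> \<tau> \<or> u \<in> non_words W \<and> v \<in> non_words W"
    and c: "congruence_on free_semigroup \<tau>" and W: "W \<subseteq> carrier free_semigroup"
    and subst: "\<And>\<phi> :: 'a \<Rightarrow> 'a list. \<And>u v. \<forall>w\<in>W. tau_term \<tau> S w \<Longrightarrow> range \<phi> \<subseteq> carrier F \<Longrightarrow>
       u \<noteq> [] \<Longrightarrow> v \<noteq> [] \<Longrightarrow> satisfies S u v \<Longrightarrow>
       concat (map \<phi> u) = concat (map \<phi> v) \<or>
       concat (map \<phi> u) \<noteq> [] \<and> concat (map \<phi> v) \<noteq> [] \<and>
         satisfies S (concat (map \<phi> u)) (concat (map \<phi> v))"
  shows "in_var S T \<longleftrightarrow> (\<forall>w\<in>W. tau_term \<tau> S w)"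
proof -
  have T: "is_semigroup T" using F(1) p by (rule is_semigroup_epi_image)
  have ph: "p \<in> hom F T" and pT: "p ` carrier F = carrier T" using p by (auto simp: epi_def)
  show ?thesis
    unfolding in_var_iff_identities[where 'a = 'a, OF S T]
  proof (intro iffI ballI allI impI)
    fix w
    assume ids: "\<forall>u v :: 'a list. u \<noteq> [] \<longrightarrow> v \<noteq> [] \<longrightarrow> satisfies S u v \<longrightarrow> satisfies T u v"
      and w: "w \<in> W"
    have pf: "p \<in> hom free_semigroup T"
      using ph all_words F(2) by (auto simp: hom_def subset_iff)
    have "(w, v) \<in> \<tau>" if v: "v \<noteq> []" "satisfies S w v" for v
    proof -
      have wv: "w \<noteq> []" "w \<in> carrier F" "v \<in> carrier F" using w W v all_words by auto
      then have "satisfies T w v" using ids v by blast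
      then have "p w = p v" using pf by (auto simp: satisfies_def)
      then show ?thesis
        using ker wv(2,3) w wv(1) tau_refl[OF c] by (auto simp: non_words_def)
    qed
    then show "tau_term \<tau> S w" by (simp add: tau_term_def)
  next
    fix u v :: "'a list"
    assume tt: "\<forall>w\<in>W. tau_term \<tau> S w" and uv: "u \<noteq> []" "v \<noteq> []" "satisfies S u v"
    have "weval T f u = weval T f v" if f: "range f \<subseteq> carrier T" for f
    proof -
      have "\<forall>x. \<exists>w. w \<in> carrier F \<and> p w = f x"
        using f pT by (metis imageE rangeI subsetD)
      then obtain \<phi> where \<phi>: "\<forall>x. \<phi> x \<in> carrier F" "\<And>x. p (\<phi> x) = f x" by metis
      define U where "U = concat (map \<phi> u)"
      define V where "V = concat (map \<phi> v)"
      have f': "p \<circ> \<phi> = f" using \<phi>(2) by auto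
      have ev: "weval T f u = p U" "weval T f v = p V"
        using hom_subst[OF F ph \<phi>(1)] uv(1,2) by (simp_all add: U_def V_def f')
      have UV: "U = V \<or> U \<noteq> [] \<and> V \<noteq> [] \<and> satisfies S U V"
        using subst[OF tt _ uv, of \<phi>] \<phi>(1) by (auto simp: U_def V_def)
      have "p U = p V" if ne: "U \<noteq> []" "V \<noteq> []" and sat: "satisfies S U V"
      proof -
        have tau: "(w, z) \<in> \<tau>" if "w \<in> W" "satisfies S w z" "z \<noteq> []" for w z
          using that tt by (simp add: tau_term_def)
        have "satisfies S V U" using sat by (auto simp: satisfies_def)
        then have "(U, V) \<in> \<tau>" if "U \<in> W \<or> V \<in> W"
          using that tau ne sat tau_sym[OF c] by blast
        moreover have "U \<in> carrier F" "V \<in> carrier F" using ne all_words by auto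
        ultimately show ?thesis using ker ne by (auto simp: non_words_def)
      qed
      then show ?thesis using UV ev by auto
    qed
    then show "satisfies T u v" using satisfies_iff[OF T uv(1,2)] by blast
  qed
qed

theorem lemma7p1:
  fixes \<tau> :: "('a::{countable,infinite} list \<times> 'a list) set"
    and W :: "'a list set"
  assumes "congruence_on free_semigroup \<tau>"
    and "\<And>x u. ([x], u) \<in> \<tau> \<Longrightarrow> \<exists>m>0. u = replicate m x"
    and "W \<noteq> {}"
    and "W \<subseteq> carrier free_semigroup"
    and "union_of_classes \<tau> W"
    and "subword_closed W"
  shows "(\<forall>S :: 's monoid. is_semigroup S \<longrightarrow>
            (in_var S (S_of \<tau> W) \<longleftrightarrow> (\<forall>w\<in>W. tau_term \<tau> S w))) \<and>
         (\<forall>S :: 'm monoid. monoid S \<longrightarrow>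
            (in_var S (S1_of \<tau> W) \<longleftrightarrow> (\<forall>w\<in>W. tau_term \<tau> S w)))"
proof (intro conjI allI impI)
  fix S :: "'s monoid" assume S: "is_semigroup S"
  obtain p where p: "p \<in> epi free_semigroup (S_of \<tau> W)"
    "\<forall>u\<in>carrier free_semigroup. \<forall>v\<in>carrier free_semigroup.
       p u = p v \<longleftrightarrow> u = v \<or> (u, v) \<in> \<tau> \<or> u \<in> non_words W \<and> v \<in> non_words W"
    using epi_S_of[OF assms(1,5,6)] by metis
  show "in_var S (S_of \<tau> W) \<longleftrightarrow> (\<forall>w\<in>W. tau_term \<tau> S w)"
  proof (rule in_var_iff_tau_terms[OF S is_semigroup_free_semigroup _ _ p assms(1,4)])
    fix \<phi> :: "'a \<Rightarrow> 'a list" and u v :: "'a list"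
    assume \<phi>: "range \<phi> \<subseteq> carrier free_semigroup" and uv: "u \<noteq> []" "v \<noteq> []" "satisfies S u v"
    have ne: "\<forall>x. \<phi> x \<noteq> []" using range_subsetD[OF \<phi>] by simp
    then have "concat (map \<phi> u) \<noteq> []" "concat (map \<phi> v) \<noteq> []" using uv by (cases u; cases v; auto)+
    then show "concat (map \<phi> u) = concat (map \<phi> v) \<or>
       concat (map \<phi> u) \<noteq> [] \<and> concat (map \<phi> v) \<noteq> [] \<and>
         satisfies S (concat (map \<phi> u)) (concat (map \<phi> v))"
      using satisfies_subst[OF S uv(1,2) ne uv(3)] by blast
  qed (auto simp: free_semigroup_def)
next
  fix S :: "'m monoid" assume S: "monoid S"
  obtain p where p: "p \<in> epi free_monoid (S1_of \<tau> W)"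
    "\<forall>u\<in>carrier free_monoid. \<forall>v\<in>carrier free_monoid.
       p u = p v \<longleftrightarrow> u = v \<or> (u, v) \<in> \<tau> \<or> u \<in> non_words W \<and> v \<in> non_words W"
    using epi_S1_of[OF assms(1,5,6)] by metis
  obtain w where w: "w \<in> W" "w \<noteq> []"
    using assms(3,4) free_semigroup_simps(1) by blast
  have "sublist [hd w] w" using w(2) by (cases w) (auto simp: sublist_Cons_right)
  then have x: "[hd w] \<in> W" using assms(6) w(1) by (auto simp: subword_closed_def)
  show "in_var S (S1_of \<tau> W) \<longleftrightarrow> (\<forall>w\<in>W. tau_term \<tau> S w)"
  proof (rule in_var_iff_tau_terms[OF is_semigroup_monoid[OF S] is_semigroup_free_monoid _ _ p
        assms(1,4)])
    fix \<phi> :: "'a \<Rightarrow> 'a list" and u v :: "'a list"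
    assume "\<forall>w\<in>W. tau_term \<tau> S w" and uv: "u \<noteq> []" "v \<noteq> []" "satisfies S u v"
    then have "tau_term \<tau> S [hd w]" using x by blast
    then show "concat (map \<phi> u) = concat (map \<phi> v) \<or>
       concat (map \<phi> u) \<noteq> [] \<and> concat (map \<phi> v) \<noteq> [] \<and>
         satisfies S (concat (map \<phi> u)) (concat (map \<phi> v))"
      using satisfies_subst_monoid[OF S uv] assms(2) by metis
  qed (auto simp: free_monoid_def)
qed

end
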